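(* Define the numbers $v_n$ by the asymptotic expansion $$V(z) \sim \sum_{n=0}^\infty v_n z^n \qquad (z\to 0^+),\qquad V(z)=\log z+\psi\left(z+\frac1z\right).$$ Then $v_n=-2B_n^*(-1)$ for every $n\ge 1$.
   Context: $\psi(z)=\Gamma'(z)/\Gamma(z)$ is the digamma function. $V(z)\sim\sum_{n\ge0} v_nz^n$ as $z\to0^+$ means that for every $N\ge 0$, $V(z)=\sum_{n=0}^N v_nz^n+O(z^{N+1})$ as $z\to 0^+$. The Bernoulli polynomials $B_r(x)$ are defined by $\frac{te^{xt}}{e^t-1}=\sum_{r\ge 0} B_r(x)\frac{t^r}{r!}$, and for $n\ge 1$ the Zagier polynomials are $B_n^*(x)=\sum_{r=0}^n \binom{n+r}{2r}\frac{B_r(x)}{n+r}$. *)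

theory Defs
  imports "HOL-Analysis.Analysis" "HOL-Library.Landau_Symbols"
    "HOL-Computational_Algebra.Formal_Power_Series"
begin

text \<open>
  The quotient is the one in the ring of formal power series: numerator and denominator both
  have constant term zero, and the library's division cancels the common factor
  (see \<open>bernoulli_poly_gen_fun\<close> below).
\<close>

definition bernoulli_poly :: "nat \<Rightarrow> real \<Rightarrow> real" where
  "bernoulli_poly r x = fact r * fps_nth (fps_X * fps_exp x / (fps_exp 1 - 1)) r"

lemma bernoulli_poly_gen_fun:
  "Abs_fps (\<lambda>r. bernoulli_poly r x / fact r) * (fps_exp 1 - 1) = fps_X * fps_exp x"
proof -
  have nth: "fps_nth (fps_exp 1 - 1 :: real fps) 1 = 1" by simp
  have ne: "fps_exp 1 - 1 \<noteq> (0 :: real fps)"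
    using nth by (metis fps_zero_nth zero_neq_one)
  have "subdegree (fps_exp 1 - 1 :: real fps) = 1"
    by (rule subdegreeI) auto
  moreover have "subdegree (fps_X * fps_exp x) = 1"
    by (rule subdegreeI) (auto simp: fps_X_def)
  ultimately have "(fps_exp 1 - 1 :: real fps) dvd fps_X * fps_exp x"
    using ne by (subst fps_dvd_iff) auto
  moreover have "Abs_fps (\<lambda>r. bernoulli_poly r x / fact r) = fps_X * fps_exp x / (fps_exp 1 - 1)"
    by (rule fps_ext) (simp add: bernoulli_poly_def)
  ultimately show ?thesis by simp
qed

text \<open>Only meaningful for \<open>n \<ge> 1\<close>; for \<open>n = 0\<close> the term \<open>r = 0\<close> would divide by zero.\<close>

definition zagier_poly :: "nat \<Rightarrow> real \<Rightarrow> real" where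
  "zagier_poly n x = (\<Sum>r=0..n. real ((n + r) choose (2 * r)) * (bernoulli_poly r x / real (n + r)))"

definition has_asymp_expansion_at_0 :: "(real \<Rightarrow> real) \<Rightarrow> (nat \<Rightarrow> real) \<Rightarrow> bool" where
  "has_asymp_expansion_at_0 f v \<longleftrightarrow>
     (\<forall>N. (\<lambda>z. f z - (\<Sum>n=0..N. v n * z ^ n)) \<in> O[at_right 0](\<lambda>z. z ^ (N + 1)))"

definition V :: "real \<Rightarrow> real" where
  "V z = ln z + Digamma (z + 1 / z)"

end

theory Submission
  imports Defs
begin

text \<open>
  Put \<open>w = z + 1/z - 2 = (1 - z)\<^sup>2 / z\<close> and \<open>u = 1/w\<close>. The expansion
  \<open>\<psi>(w + 1 - x) \<sim> log w - \<Sum>\<^sub>r B\<^sub>r(x) / (r w\<^sup>r)\<close> as \<open>w \<rightarrow> \<infinity>\<close> holds because the error of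
  its truncation tends to \<open>0\<close> and changes by only a high power of \<open>1/w\<close> when \<open>w\<close> is
  replaced by \<open>w + 1\<close>. At \<open>x = -1\<close> it gives
  \<open>V(z) \<sim> 2 log (1 - z) - \<Sum>\<^sub>r B\<^sub>r(-1) u\<^sup>r / r\<close>, and since
  \<open>z\<^sup>r / (1 - z)\<^bsup>2r\<^esup> = \<Sum>\<^sub>n (n + r - 1 choose n - r) z\<^sup>n\<close>, the right-hand side is
  \<open>-2 \<Sum>\<^sub>n B\<^sub>n\<^sup>*(-1) z\<^sup>n\<close>.
\<close>

section \<open>Identities for Bernoulli polynomials from the generating function\<close>

text \<open>Passing from \<open>x\<close> to \<open>x + y\<close> multiplies the generating function
  by \<open>fps_exp y\<close>. This is seen after multiplying by \<open>fps_exp 1 - 1\<close>, which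
  can be cancelled as formal power series over the reals have no zero divisors.\<close>

lemma bernoulli_poly_add:
  "bernoulli_poly m (x + y) =
     (\<Sum>r\<le>m. real (m choose r) * bernoulli_poly r x * y ^ (m - r))"
proof -
  let ?G = "\<lambda>x. Abs_fps (\<lambda>r. bernoulli_poly r x / fact r)"
  have ne: "fps_exp 1 - 1 \<noteq> (0 :: real fps)"
    by (auto simp: fps_eq_iff intro!: exI[of _ 1])
  have "?G (x + y) * (fps_exp 1 - 1) = (?G x * (fps_exp 1 - 1)) * fps_exp y"
    by (simp only: bernoulli_poly_gen_fun fps_exp_add_mult mult.assoc)
  hence "?G (x + y) * (fps_exp 1 - 1) = (?G x * fps_exp y) * (fps_exp 1 - 1)"
    by (simp add: algebra_simps)
  hence "?G (x + y) = ?G x * fps_exp y"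
    using ne by simp
  hence "fps_nth (?G (x + y)) m = fps_nth (?G x * fps_exp y) m"
    by simp
  hence "bernoulli_poly m (x + y) / fact m =
           (\<Sum>r\<le>m. bernoulli_poly r x / fact r * (y ^ (m - r) / fact (m - r)))"
    by (simp only: fps_mult_nth fps_nth_Abs_fps fps_exp_nth atLeast0AtMost of_nat_fact)
  hence "bernoulli_poly m (x + y) =
           fact m * (\<Sum>r\<le>m. bernoulli_poly r x / fact r * (y ^ (m - r) / fact (m - r)))"
    by (metis fact_nonzero nonzero_mult_div_cancel_left times_divide_eq_right)
  also have "\<dots> = (\<Sum>r\<le>m. real (m choose r) * bernoulli_poly r x * y ^ (m - r))"
    unfolding sum_distrib_left by (intro sum.cong) (auto simp: binomial_fact field_simps)
  finally show ?thesis .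
qed

text \<open>The shift by 1 multiplies the right-hand side \<open>fps_X * fps_exp x\<close> of the
  generating identity by \<open>fps_exp 1\<close>, so the difference carries the very factor
  \<open>fps_exp 1 - 1\<close> that is cancelled.\<close>

lemma bernoulli_poly_plus_1:
  "bernoulli_poly m (x + 1) - bernoulli_poly m x = real m * x ^ (m - 1)"
proof -
  let ?G = "\<lambda>x. Abs_fps (\<lambda>r. bernoulli_poly r x / fact r)"
  have ne: "fps_exp 1 - 1 \<noteq> (0 :: real fps)"
    by (auto simp: fps_eq_iff intro!: exI[of _ 1])
  have "(?G (x + 1) - ?G x) * (fps_exp 1 - 1) =
          ?G (x + 1) * (fps_exp 1 - 1) - ?G x * (fps_exp 1 - 1)"
    by (simp only: left_diff_distrib)
  also have "\<dots> = (fps_X * fps_exp x) * (fps_exp 1 - 1)"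
    by (simp only: bernoulli_poly_gen_fun fps_exp_add_mult) (simp add: algebra_simps)
  finally have "?G (x + 1) - ?G x = fps_X * fps_exp x"
    using ne by (simp only: mult_cancel_right) simp
  hence "fps_nth (?G (x + 1) - ?G x) m = fps_nth (fps_X * fps_exp x) m"
    by simp
  hence *: "(bernoulli_poly m (x + 1) - bernoulli_poly m x) / fact m =
              (if m = 0 then 0 else x ^ (m - 1) / fact (m - 1))"
    by (simp add: diff_divide_distrib)
  show ?thesis
  proof (cases m)
    case (Suc k)
    from * have "bernoulli_poly m (x + 1) - bernoulli_poly m x = fact m * (x ^ k / fact k)"
      by (simp add: Suc del: fact_Suc) (simp add: divide_eq_eq mult.commute del: fact_Suc)
    thus ?thesis by (simp add: Suc)
  qed (use * in simp)
qed

lemma bernoulli_poly_0 [simp]: "bernoulli_poly 0 x = 1"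
proof -
  have "fps_nth (Abs_fps (\<lambda>r. bernoulli_poly r x / fact r) * (fps_exp 1 - 1)) 1 =
          fps_nth (fps_X * fps_exp x) 1"
    by (simp only: bernoulli_poly_gen_fun)
  thus ?thesis by (simp add: fps_mult_nth)
qed

section \<open>Power series at 0 and their truncation errors\<close>

lemma fps_nth_inverse_power_linear:
  fixes c :: real
  assumes "r > 0"
  shows "fps_nth (inverse ((1 - fps_const c * fps_X) ^ r)) n =
           c ^ n * real ((n + r - 1) choose n)"
proof -
  have "real r + real n - 1 = real (n + r - 1)"
    using assms by (simp add: of_nat_diff)
  hence "(- real r gchoose n) = (-1) ^ n * real ((n + r - 1) choose n)"
    by (simp add: gbinomial_minus binomial_gbinomial)
  thus ?thesis
    by (simp add: one_minus_fps_X_const_neg_power flip: power_mult_distrib mult.assoc)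
qed

lemma has_fps_expansion_linear_power:
  fixes c :: real
  shows "(\<lambda>z. z ^ k / (1 - c * z) ^ r) has_fps_expansion
           fps_X ^ k * inverse ((1 - fps_const c * fps_X) ^ r)"
proof -
  have "(\<lambda>z. (1 - c * z) ^ r) has_fps_expansion (1 - fps_const c * fps_X) ^ r"
    by (induction r) (auto intro!: fps_expansion_intros)
  thus ?thesis
    unfolding divide_inverse by (intro fps_expansion_intros) (auto simp: fps_nth_power_0)
qed

text \<open>The Mercator series. Its coefficient at \<open>n = 0\<close> is \<open>1 / 0 = 0\<close>
  by convention, which agrees with ln 1 = 0.\<close>

lemma has_fps_expansion_ln_linear:
  fixes c :: real
  shows "(\<lambda>z. ln (1 - c * z)) has_fps_expansion Abs_fps (\<lambda>n. - (c ^ n / real n))"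
proof (rule has_fps_expansionI)
  have "((\<lambda>z. \<bar>- (c * z)\<bar>) \<longlongrightarrow> \<bar>- (c * 0)\<bar>) (nhds 0)"
    by (intro tendsto_intros filterlim_ident)
  hence "eventually (\<lambda>z. \<bar>- (c * z)\<bar> < 1) (nhds 0)"
    by (rule order_tendstoD) auto
  thus "eventually (\<lambda>z. (\<lambda>n. fps_nth (Abs_fps (\<lambda>n. - (c ^ n / real n))) n * z ^ n)
          sums ln (1 - c * z)) (nhds 0)"
  proof eventually_elim
    case (elim z)
    from ln_series'[OF this] show ?case
      by (simp add: power_mult_distrib)
  qed
qed

text \<open>Subtracting the truncation leaves a series \<open>G\<close> that starts at order
  \<open>N + 1\<close> or later; dividing by \<open>z ^ (N + 1)\<close> gives a function with a
  finite limit at 0. The case \<open>G = 0\<close> is separate because the subdegree of 0 is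
  0.\<close>

lemma has_fps_expansion_imp_bigo:
  fixes f :: "real \<Rightarrow> real"
  assumes "f has_fps_expansion F" and coeff: "\<And>n. n \<le> N \<Longrightarrow> fps_nth F n = v n"
  shows "(\<lambda>z. f z - (\<Sum>n=0..N. v n * z ^ n)) \<in> O[at_right 0](\<lambda>z. z ^ (N + 1))"
proof -
  define G where "G = F - (\<Sum>n=0..N. fps_const (v n) * fps_X ^ n)"
  define g where "g = (\<lambda>z. f z - (\<Sum>n=0..N. v n * z ^ n))"
  have g: "g has_fps_expansion G"
    unfolding g_def G_def by (intro fps_expansion_intros assms)
  have G0: "fps_nth G n = 0" if "n < N + 1" for n
    using that coeff[of n] by (simp add: G_def fps_sum_nth fps_X_power_nth if_distrib cong: if_cong)
  show ?thesis
  proof (cases "G = 0")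
    case True
    with g have "eventually (\<lambda>z. g z = 0) (nhds 0)"
      by (auto simp: has_fps_expansion_def elim: eventually_mono)
    hence "eventually (\<lambda>z. g z = 0) (at_right 0)"
      by (auto simp: eventually_at_filter elim: eventually_mono)
    thus ?thesis
      unfolding g_def by (intro bigoI[of _ 0]) (auto elim: eventually_mono)
  next
    case False
    hence "N + 1 \<le> subdegree G"
      by (intro subdegree_geI G0)
    from has_fps_expansion_imp_continuous[OF has_fps_expansion_shift[OF g this refl]]
    have lim: "((\<lambda>z. if z = 0 then fps_nth G (N + 1) else g z / z ^ (N + 1))
                 \<longlongrightarrow> fps_nth G (N + 1)) (at_right 0)"
      by (simp add: continuous_within)
    have "((\<lambda>z. g z / z ^ (N + 1)) \<longlongrightarrow> fps_nth G (N + 1)) (at_right 0)"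
      by (rule Lim_transform_eventually[OF lim])
         (auto simp: eventually_at_filter)
    thus ?thesis
      unfolding g_def
      by (intro bigoI_tendsto) (auto simp: eventually_at_filter)
  qed
qed

lemma has_fps_expansion_imp_bigo_power:
  fixes f :: "real \<Rightarrow> real"
  assumes "f has_fps_expansion F" and "\<And>n. n \<le> N \<Longrightarrow> fps_nth F n = 0"
  shows "f \<in> O[at_right 0](\<lambda>z. z ^ (N + 1))"
  using has_fps_expansion_imp_bigo[OF assms(1), of N "\<lambda>_. 0"] assms(2) by simp

section \<open>Uniqueness of asymptotic expansions\<close>

text \<open>Strong induction: once all lower coefficients agree, the two truncations at
  \<open>n\<close> differ by a multiple of \<open>z ^ n\<close> that is
  O(\<open>z ^ (n + 1)\<close>), so the multiple is 0.\<close>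

lemma has_asymp_expansion_at_0_unique:
  assumes "has_asymp_expansion_at_0 f v" "has_asymp_expansion_at_0 f w"
  shows "v = w"
proof
  fix n show "v n = w n"
  proof (induction n rule: less_induct)
    case (less n)
    have "(\<lambda>z. (f z - (\<Sum>k=0..n. v k * z ^ k)) - (f z - (\<Sum>k=0..n. w k * z ^ k)))
            \<in> O[at_right 0](\<lambda>z. z ^ (n + 1))"
      using assms[unfolded has_asymp_expansion_at_0_def, rule_format, of n]
      by (rule sum_in_bigo(2))
    also have "(\<lambda>z. (f z - (\<Sum>k=0..n. v k * z ^ k)) - (f z - (\<Sum>k=0..n. w k * z ^ k))) =
                 (\<lambda>z. (w n - v n) * z ^ n)"
    proof
      fix z :: real
      have "(f z - (\<Sum>k=0..n. v k * z ^ k)) - (f z - (\<Sum>k=0..n. w k * z ^ k)) =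
              (\<Sum>k=0..n. (w k - v k) * z ^ k)"
        by (simp add: sum_subtractf algebra_simps)
      also have "\<dots> = (\<Sum>k\<in>{n}. (w k - v k) * z ^ k)"
        using less.IH by (intro sum.mono_neutral_right) auto
      finally show "(f z - (\<Sum>k=0..n. v k * z ^ k)) - (f z - (\<Sum>k=0..n. w k * z ^ k)) =
                      (w n - v n) * z ^ n" by simp
    qed
    finally have *: "(\<lambda>z. (w n - v n) * z ^ n) \<in> O[at_right 0](\<lambda>z. z ^ (n + 1))" .
    have small: "(\<lambda>z::real. z ^ (n + 1)) \<in> o[at_right 0](\<lambda>z. z ^ n)"
    proof (rule smalloI_tendsto)
      have "((\<lambda>z::real. z) \<longlongrightarrow> 0) (at_right 0)"
        by (rule tendsto_ident_at)
      thus "((\<lambda>z::real. z ^ (n + 1) / z ^ n) \<longlongrightarrow> 0) (at_right 0)"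
        by (rule Lim_transform_eventually) (auto simp: eventually_at_filter)
      show "eventually (\<lambda>z::real. z ^ n \<noteq> 0) (at_right 0)"
        by (rule eventually_mono[OF eventually_at_right_less]) simp
    qed
    show "v n = w n"
    proof (rule ccontr)
      assume "v n \<noteq> w n"
      with * have "(\<lambda>z::real. z ^ n) \<in> O[at_right 0](\<lambda>z. z ^ (n + 1))"
        by simp
      \<comment> \<open>Now \<open>z ^ n\<close> is little-o of itself, so it would vanish for all
        small positive \<open>z\<close>.\<close>
      from landau_o.big_small_trans[OF this small]
      have "eventually (\<lambda>z::real. z ^ n = 0) (at_right 0)"
        by (simp add: landau_o.small_refl_iff)
      moreover have "eventually (\<lambda>z::real. z > 0) (at_right 0)"
        by (rule eventually_at_right_less)
      ultimately have "eventually (\<lambda>_::real. False) (at_right 0)"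
        by eventually_elim auto
      thus False by simp
    qed
  qed
qed

section \<open>Asymptotics of the digamma function at infinity\<close>

text \<open>
  The coefficients cancel because \<open>m\<close> times the \<open>m\<close>-th one is
  \<open>B\<^sub>m(x) - B\<^sub>m(x - 1) - m (x - 1)\<^bsup>m-1\<^esup>\<close>.
\<close>
lemma bernoulli_ln_shift_bigo:
  "(\<lambda>t. ln (1 + t) - (\<Sum>r=1..M. bernoulli_poly r x / real r * (t ^ r / (1 + t) ^ r - t ^ r))
          - t / (1 - (x - 1) * t)) \<in> O[at_right 0](\<lambda>t. t ^ (M + 1))"
proof -
  define F where "F = Abs_fps (\<lambda>n. - ((-1) ^ n / real n))
     - (\<Sum>r=1..M. fps_const (bernoulli_poly r x / real r) *
          (fps_X ^ r * inverse ((1 - fps_const (-1) * fps_X) ^ r) - fps_X ^ r))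
     - fps_X ^ 1 * inverse ((1 - fps_const (x - 1) * fps_X) ^ 1)"
  have "(\<lambda>t. ln (1 - (-1) * t) -
           (\<Sum>r=1..M. bernoulli_poly r x / real r * (t ^ r / (1 - (-1) * t) ^ r - t ^ r))
           - t ^ 1 / (1 - (x - 1) * t) ^ 1) has_fps_expansion F"
    unfolding F_def
    by (intro fps_expansion_intros has_fps_expansion_linear_power has_fps_expansion_ln_linear)
  moreover have "fps_nth F m = 0" if "m \<le> M" for m
  proof (cases "m = 0")
    case True
    thus ?thesis by (auto simp: F_def fps_sum_nth fps_X_power_mult_nth fps_X_power_nth)
  next
    case False
    \<comment> \<open>\<open>a r\<close> is the coefficient of \<open>t ^ m\<close> in the summand
      with \<open>t ^ r / (1 + t) ^ r\<close>.\<close>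
    define a where "a = (\<lambda>r. bernoulli_poly r x / real r *
      (if m < r then 0 else (-1) ^ (m - r) * real ((m - 1) choose (m - r))))"
    have coeff: "fps_nth (fps_X ^ r * inverse ((1 - fps_const (-1) * fps_X) ^ r)) m =
            (if m < r then 0 else (-1) ^ (m - r) * real ((m - 1) choose (m - r)))"
      if "r > 0" for r
      using fps_nth_inverse_power_linear[OF that, of "-1" "m - r"]
      by (simp only: fps_X_power_mult_nth) simp
    have coeff1: "fps_nth (fps_X ^ 1 * inverse ((1 - fps_const (x - 1) * fps_X) ^ 1)) m =
            (x - 1) ^ (m - 1)"
      using False fps_nth_inverse_power_linear[of 1 "x - 1" "m - 1"]
      by (simp only: fps_X_power_mult_nth) simp
    have "fps_nth F m = - ((-1) ^ m / real m)
            - (\<Sum>r=1..M. a r - (if r = m then bernoulli_poly r x / real r else 0))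
            - (x - 1) ^ (m - 1)"
      unfolding F_def fps_sub_nth fps_nth_Abs_fps fps_sum_nth fps_mult_left_const_nth coeff1
      by (intro arg_cong2[where f = "(-)"] refl sum.cong)
         (auto simp: a_def coeff fps_X_power_nth right_diff_distrib simp del: fps_const_neg)
    also have "(\<Sum>r=1..M. a r - (if r = m then bernoulli_poly r x / real r else 0)) =
                 (\<Sum>r=1..M. a r) - bernoulli_poly m x / real m"
      using that False by (simp add: sum_subtractf)
    also have "(\<Sum>r=1..M. a r) = (\<Sum>r=1..m. a r)"
      using that by (intro sum.mono_neutral_right) (auto simp: a_def)
    also have "(\<Sum>r=1..m. a r) =
                 (\<Sum>r=1..m. real (m choose r) * bernoulli_poly r x * (-1) ^ (m - r)) / real m"
      unfolding sum_divide_distrib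
    proof (intro sum.cong refl)
      fix r assume r: "r \<in> {1..m}"
      \<comment> \<open>Absorption trades the factor \<open>1 / r\<close> for \<open>1 / m\<close>,
        which turns the sum into the one in \<open>bernoulli_poly_add\<close>.\<close>
      have "m * ((m - 1) choose (r - 1)) = r * (m choose r)"
        using times_binomial_minus1_eq[of r m] r by simp
      moreover have "(m - 1) choose (m - r) = (m - 1) choose (r - 1)"
      proof -
        have "r - 1 \<le> m - 1" "m - 1 - (r - 1) = m - r" using r by auto
        thus ?thesis by (metis binomial_symmetric)
      qed
      ultimately have "real m * real ((m - 1) choose (m - r)) = real r * real (m choose r)"
        by (metis of_nat_mult)
      thus "a r = real (m choose r) * bernoulli_poly r x * (-1) ^ (m - r) / real m"
        using r by (simp add: a_def field_simps)
    qed
    \<comment> \<open>The addition formula with \<open>y = -1\<close>. Its term \<open>r = 0\<close>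
      is missing here; that term, \<open>(-1) ^ m\<close>, cancels the coefficient of the
      logarithm.\<close>
    also have "(\<Sum>r=1..m. real (m choose r) * bernoulli_poly r x * (-1) ^ (m - r)) =
                 bernoulli_poly m (x - 1) - (-1) ^ m"
      using bernoulli_poly_add[of m x "-1"]
      by (simp add: atMost_atLeast0 sum.atLeast_Suc_atMost)
    also have "(x - 1) ^ (m - 1) = (bernoulli_poly m x - bernoulli_poly m (x - 1)) / real m"
      using bernoulli_poly_plus_1[of m "x - 1"] False by simp
    finally show ?thesis
      using False by (simp add: field_simps)
  qed
  ultimately show ?thesis
    using has_fps_expansion_imp_bigo_power[of _ F M] by simp
qed

text \<open>The sum in the limit formula for \<psi>(a) is \<psi>(a + m) - \<psi>(a) by the
  recurrence. This limit fixes the constant that difference equations leave open.\<close>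

lemma Digamma_minus_ln_tendsto_0:
  fixes a :: real
  assumes "a > 0"
  shows "(\<lambda>k. Digamma (a + real k) - ln (real k)) \<longlonglongrightarrow> 0"
proof -
  have "(\<lambda>m. Digamma a - (ln (real m) - (\<Sum>n<m. inverse (a + real n)))) \<longlonglongrightarrow>
          Digamma a - Digamma a"
    using Digamma_LIMSEQ[of a] assms by (intro tendsto_intros) simp
  moreover have "Digamma (a + real m) = Digamma a + (\<Sum>n<m. inverse (a + real n))" for m
  proof -
    have "a \<noteq> - real k" for k using assms by (auto simp: add_pos_nonneg less_imp_neq)
    thus ?thesis using Polygamma_plus_of_nat[of m a 0] by (simp add: inverse_eq_divide)
  qed
  ultimately show ?thesis by (simp add: algebra_simps)
qed

text \<open>Two factors of the power are spent on a telescoping bound; the other \<open>M\<close>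
  are bounded below by \<open>w\<close>, so that summation over \<open>k\<close> keeps the decay
  \<open>1 / w ^ M\<close>.\<close>

lemma inverse_power_Suc_le_telescope:
  fixes w :: real
  assumes "w > 1"
  shows "1 / (w + real k) ^ (M + 2) \<le> 1 / w ^ M * (1 / (w + real k - 1) - 1 / (w + real k))"
proof -
  define y where "y = w + real k"
  have y: "y \<ge> w" "y > 1" using assms by (auto simp: y_def)
  have "1 / y ^ (M + 2) = 1 / y ^ M * (1 / y ^ 2)"
    by (simp add: power_add power2_eq_square)
  also have "\<dots> \<le> 1 / w ^ M * (1 / ((y - 1) * y))"
  proof (intro mult_mono)
    show "1 / y ^ M \<le> 1 / w ^ M"
      using assms y by (intro divide_left_mono power_mono mult_pos_pos) auto
    show "1 / y ^ 2 \<le> 1 / ((y - 1) * y)"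
      using y by (intro divide_left_mono mult_pos_pos) (auto simp: power2_eq_square)
  qed (use assms y in auto)
  also have "1 / ((y - 1) * y) = 1 / (y - 1) - 1 / y"
    using y by (simp add: field_simps)
  finally show ?thesis by (simp add: y_def)
qed

text \<open>As \<open>f\<close> tends to 0 along \<open>w, w + 1, ...\<close>, the value
  \<open>f w\<close> is minus the sum of the increments. Telescoping bounds this sum, at the cost of
  one power of \<open>1 / w\<close>.\<close>

lemma bigo_of_difference_bigo:
  fixes f :: "real \<Rightarrow> real"
  assumes diff: "(\<lambda>w. f (w + 1) - f w) \<in> O[at_top](\<lambda>w. (1 / w) ^ (M + 2))"
    and lim: "eventually (\<lambda>w. (\<lambda>k. f (w + real k)) \<longlonglongrightarrow> 0) at_top"
  shows "f \<in> O[at_top](\<lambda>w. (1 / w) ^ (M + 1))"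
proof -
  obtain C where C: "C > 0"
    "eventually (\<lambda>w. norm (f (w + 1) - f w) \<le> C * norm ((1 / w) ^ (M + 2))) at_top"
    using landau_o.bigE[OF diff] by blast
  then obtain W where W:
    "\<And>w. w \<ge> W \<Longrightarrow> norm (f (w + 1) - f w) \<le> C * norm ((1 / w) ^ (M + 2))"
    by (auto simp: eventually_at_top_linorder)
  have "eventually (\<lambda>w. norm (f w) \<le> (2 * C) * norm ((1 / w) ^ (M + 1))) at_top"
    using lim eventually_ge_at_top[of W] eventually_ge_at_top[of 2]
  proof eventually_elim
    case (elim w)
    have bound: "\<bar>f w - f (w + real k)\<bar> \<le> C / w ^ M * (1 / (w - 1))" for k
    proof -
      have "\<bar>f w - f (w + real k)\<bar> \<le>
              C / w ^ M * (1 / (w - 1) - 1 / (w + real k - 1))"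
      proof (induction k)
        case (Suc k)
        have "\<bar>f (w + real k + 1) - f (w + real k)\<bar> \<le> C * (1 / (w + real k) ^ (M + 2))"
          using W[of "w + real k"] elim by (simp add: power_one_over)
        also have "\<dots> \<le> C * (1 / w ^ M * (1 / (w + real k - 1) - 1 / (w + real k)))"
          using C(1) elim by (intro mult_left_mono inverse_power_Suc_le_telescope) auto
        finally have "\<bar>f (w + real k + 1) - f (w + real k)\<bar> \<le>
            C / w ^ M * (1 / (w + real k - 1) - 1 / (w + real k))" by simp
        with Suc.IH have "\<bar>f w - f (w + real k + 1)\<bar> \<le>
            C / w ^ M * (1 / (w - 1) - 1 / (w + real k - 1)) +
            C / w ^ M * (1 / (w + real k - 1) - 1 / (w + real k))" by linarith
        thus ?case by (simp add: algebra_simps)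
      qed simp
      also have "\<dots> \<le> C / w ^ M * (1 / (w - 1))"
        using C(1) elim by (intro mult_left_mono) auto
      finally show ?thesis .
    qed
    have "(\<lambda>k. \<bar>f w - f (w + real k)\<bar>) \<longlonglongrightarrow> \<bar>f w - 0\<bar>"
      by (intro tendsto_intros elim)
    hence "\<bar>f w\<bar> \<le> C / w ^ M * (1 / (w - 1))"
      using bound by (intro tendsto_upperbound[where F = sequentially]) auto
    \<comment> \<open>This uses \<open>w \<ge> 2\<close>.\<close>
    also have "\<dots> \<le> C / w ^ M * (2 / w)"
      using C(1) elim by (intro mult_left_mono) (auto simp: field_simps)
    finally show ?case using elim by (simp add: power_one_over mult_ac)
  qed
  thus ?thesis by (rule landau_o.bigI[rotated]) (use C(1) in simp)
qed

lemma Digamma_bernoulli_asymptotics: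
  "(\<lambda>w. Digamma (w + 1 - x) - (ln w - (\<Sum>r=1..M + 1. bernoulli_poly r x / real r * (1 / w) ^ r)))
     \<in> O[at_top](\<lambda>w. (1 / w) ^ (M + 1))"
  (is "?f \<in> _")
proof (rule bigo_of_difference_bigo)
  \<comment> \<open>The increment \<open>?f (w + 1) - ?f w\<close> equals
    \<open>- ?D (1 / w)\<close>. Cutting the sum at \<open>M + 1\<close> makes it of order
    \<open>M + 2\<close>, as the difference lemma requires.\<close>
  let ?D = "\<lambda>t. ln (1 + t)
     - (\<Sum>r=1..M + 1. bernoulli_poly r x / real r * (t ^ r / (1 + t) ^ r - t ^ r))
     - t / (1 - (x - 1) * t)"
  have "filterlim (\<lambda>w::real. inverse w) (at_right 0) at_top"
    by (rule filterlim_inverse_at_right_top)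
  hence "filterlim (\<lambda>w::real. 1 / w) (at_right 0) at_top"
    by (simp add: inverse_eq_divide)
  from landau_o.big.compose[OF bernoulli_ln_shift_bigo[of x "M + 1"] this]
  have "(\<lambda>w. ?D (1 / w)) \<in> O[at_top](\<lambda>w. (1 / w) ^ (M + 2))"
    by (simp only: add.assoc one_add_one)
  hence "(\<lambda>w. - ?D (1 / w)) \<in> O[at_top](\<lambda>w. (1 / w) ^ (M + 2))"
    by (simp only: landau_o.big.uminus_in_iff)
  also have "?this \<longleftrightarrow> (\<lambda>w. ?f (w + 1) - ?f w) \<in> O[at_top](\<lambda>w. (1 / w) ^ (M + 2))"
  proof (rule landau_o.big.in_cong)
    show "eventually (\<lambda>w. - ?D (1 / w) = ?f (w + 1) - ?f w) at_top"
      using eventually_gt_at_top[of 0] eventually_gt_at_top[of "x - 1"]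
    proof eventually_elim
      case (elim w)
      have "Digamma (w + 1 - x + 1) = Digamma (w + 1 - x) + 1 / (w + 1 - x)"
        using elim by (intro Digamma_plus1) auto
      moreover have "w + 1 - x + 1 = w + 1 + 1 - x" by simp
      ultimately have 1: "Digamma (w + 1 + 1 - x) = Digamma (w + 1 - x) + 1 / (w + 1 - x)"
        by simp
      have "1 + 1 / w = (w + 1) / w" using elim by (simp add: field_simps)
      hence 2: "ln (1 + 1 / w) = ln (w + 1) - ln w"
        using elim by (simp add: ln_div)
      have "1 / w / (1 + 1 / w) = 1 / (w + 1)" using elim by (simp add: field_simps)
      hence 3: "(1 / w) ^ r / (1 + 1 / w) ^ r = (1 / (w + 1)) ^ r" for r
        by (metis power_divide)
      have 4: "1 / w / (1 - (x - 1) * (1 / w)) = 1 / (w + 1 - x)"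
        using elim by (simp add: field_simps)
      show ?case
        unfolding 1 2 3 4 by (simp add: right_diff_distrib sum_subtractf)
    qed
  qed
  finally show "(\<lambda>w. ?f (w + 1) - ?f w) \<in> O[at_top](\<lambda>w. (1 / w) ^ (M + 2))" .
next
  show "eventually (\<lambda>w. (\<lambda>k. ?f (w + real k)) \<longlonglongrightarrow> 0) at_top"
    using eventually_gt_at_top[of 0] eventually_gt_at_top[of "x - 1"]
  proof eventually_elim
    case (elim w)
    have k: "filterlim (\<lambda>k. w + real k) at_top sequentially"
      by (intro filterlim_tendsto_add_at_top[OF tendsto_const] filterlim_real_sequentially)
    have inv: "(\<lambda>k. 1 / (w + real k)) \<longlonglongrightarrow> 0"
      by (intro tendsto_divide_0[OF tendsto_const] filterlim_at_top_imp_at_infinity k)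
    have "(\<lambda>k. \<Sum>r=1..M + 1. bernoulli_poly r x / real r * (1 / (w + real k)) ^ r)
            \<longlonglongrightarrow> (\<Sum>r=1..M + 1. bernoulli_poly r x / real r * 0 ^ r)"
      by (intro tendsto_intros inv)
    hence sum0: "(\<lambda>k. \<Sum>r=1..M + 1. bernoulli_poly r x / real r * (1 / (w + real k)) ^ r)
            \<longlonglongrightarrow> 0"
      by (simp add: power_0_left)
    \<comment> \<open>This replaces \<open>ln (w + real k)\<close> in \<open>?f\<close> by
      \<open>ln (real k)\<close>, the logarithm in the known digamma limit.\<close>
    have "(\<lambda>k. ln (1 + w / real k)) \<longlonglongrightarrow> ln (1 + 0)"
      by (intro tendsto_intros tendsto_divide_0[OF tendsto_const]
            filterlim_at_top_imp_at_infinity filterlim_real_sequentially) auto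
    moreover have "eventually (\<lambda>k. ln (1 + w / real k) = ln (w + real k) - ln (real k)) sequentially"
      using eventually_gt_at_top[of 0]
    proof eventually_elim
      case (elim k)
      hence "1 + w / real k = (w + real k) / real k" by (simp add: field_simps)
      thus ?case using elim \<open>w > 0\<close> by (simp add: ln_div)
    qed
    ultimately have ln: "(\<lambda>k. ln (w + real k) - ln (real k)) \<longlonglongrightarrow> 0"
      by (simp add: Lim_transform_eventually)
    have "(\<lambda>k. (Digamma (w + 1 - x + real k) - ln (real k)) - (ln (w + real k) - ln (real k))
            + (\<Sum>r=1..M + 1. bernoulli_poly r x / real r * (1 / (w + real k)) ^ r)) \<longlonglongrightarrow> 0 - 0 + 0"
      using elim by (intro tendsto_add tendsto_diff Digamma_minus_ln_tendsto_0 ln sum0) auto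
    moreover have "w + 1 - x + real k = w + real k + 1 - x" for k by simp
    ultimately show ?case by (simp add: algebra_simps)
  qed
qed

section \<open>Zagier polynomials and the expansion of V\<close>

text \<open>
  Truncated form of \<open>\<Sum>\<^sub>n B\<^sub>n\<^sup>*(x) z\<^sup>n = - log (1 - z) + \<Sum>\<^sub>r B\<^sub>r(x) u\<^sup>r / (2 r)\<close> with
  \<open>u = z / (1 - z)\<^sup>2\<close>.
\<close>
lemma fps_nth_zagier_poly:
  assumes "1 \<le> n" "n \<le> N"
  shows "fps_nth (\<Sum>r=1..N. fps_const (bernoulli_poly r x / real r) *
             (fps_X ^ r * inverse ((1 - fps_const 1 * fps_X) ^ (2 * r)))) n =
           2 * zagier_poly n x - 2 / real n"
proof -
  have "fps_nth (\<Sum>r=1..N. fps_const (bernoulli_poly r x / real r) *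
             (fps_X ^ r * inverse ((1 - fps_const 1 * fps_X) ^ (2 * r)))) n =
          (\<Sum>r=1..N. bernoulli_poly r x / real r *
             (if n < r then 0 else real ((n - r + 2 * r - 1) choose (n - r))))"
    unfolding fps_sum_nth
    by (intro sum.cong refl, unfold fps_mult_left_const_nth fps_X_power_mult_nth,
        subst fps_nth_inverse_power_linear) auto
  \<comment> \<open>For \<open>r > n\<close> the factor \<open>fps_X ^ r\<close> leaves no term of
    degree \<open>n\<close>.\<close>
  also have "\<dots> = (\<Sum>r=1..n. bernoulli_poly r x / real r *
             (if n < r then 0 else real ((n - r + 2 * r - 1) choose (n - r))))"
    using assms by (intro sum.mono_neutral_right) auto
  also have "\<dots> = (\<Sum>r=1..n. 2 * (real ((n + r) choose (2 * r)) * (bernoulli_poly r x / real (n + r))))"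
  proof (intro sum.cong refl)
    fix r assume r: "r \<in> {1..n}"
    have "(n + r - 1) choose (n - r) = (n + r - 1) choose (2 * r - 1)"
    proof -
      have "n - r \<le> n + r - 1" "n + r - 1 - (n - r) = 2 * r - 1" using r by auto
      thus ?thesis by (metis binomial_symmetric)
    qed
    \<comment> \<open>Absorption with lower index \<open>2 * r\<close> produces the denominator
      \<open>n + r\<close> of the Zagier polynomial.\<close>
    moreover have "2 * r * ((n + r) choose (2 * r)) = (n + r) * ((n + r - 1) choose (2 * r - 1))"
      using times_binomial_minus1_eq[of "2 * r" "n + r"] r by simp
    ultimately have "2 * real r * real ((n + r) choose (2 * r)) =
                       real (n + r) * real ((n + r - 1) choose (n - r))"
      by (metis of_nat_mult of_nat_numeral)
    moreover have "n - r + 2 * r - 1 = n + r - 1" using r by simp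
    ultimately show "bernoulli_poly r x / real r *
             (if n < r then 0 else real ((n - r + 2 * r - 1) choose (n - r))) =
          2 * (real ((n + r) choose (2 * r)) * (bernoulli_poly r x / real (n + r)))"
      using r by (simp add: field_simps del: of_nat_add)
  qed
  \<comment> \<open>The subtracted \<open>2 / n\<close> is twice the term \<open>r = 0\<close> of
    \<open>zagier_poly\<close>, which the sum from 1 lacks.\<close>
  also have "\<dots> = 2 * zagier_poly n x - 2 / real n"
    using assms by (simp add: zagier_poly_def sum.atLeast_Suc_atMost sum_distrib_left)
  finally show ?thesis .
qed

text \<open>The prescribed value at \<open>n = 0\<close> overrides the junk value of \<open>zagier_poly 0\<close>.\<close>
lemma has_asymp_expansion_at_0_V:
  "has_asymp_expansion_at_0 V (\<lambda>n. if n = 0 then 0 else - 2 * zagier_poly n (- 1))"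
  (is "has_asymp_expansion_at_0 V ?v")
  unfolding has_asymp_expansion_at_0_def
proof
  fix N
  let ?B = "\<lambda>r. bernoulli_poly r (- 1) / real r"
  \<comment> \<open>The approximation to \<open>V\<close> once ln z has cancelled. The factors
    \<open>1 * z\<close> match the expansion lemmas at \<open>c = 1\<close>.\<close>
  define g where "g = (\<lambda>z. 2 * ln (1 - 1 * z) - (\<Sum>r=1..N + 1. ?B r * (z ^ r / (1 - 1 * z) ^ (2 * r))))"
  define G where "G = fps_const 2 * Abs_fps (\<lambda>n. - (1 ^ n / real n)) -
     (\<Sum>r=1..N + 1. fps_const (?B r) * (fps_X ^ r * inverse ((1 - fps_const 1 * fps_X) ^ (2 * r))))"
  have "g has_fps_expansion G"
    unfolding g_def G_def
    by (intro fps_expansion_intros has_fps_expansion_linear_power has_fps_expansion_ln_linear)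
  moreover have "fps_nth G n = ?v n" if "n \<le> N" for n
  proof (cases "n = 0")
    case True
    thus ?thesis by (auto simp: G_def fps_sum_nth fps_X_power_mult_nth)
  next
    case False
    \<comment> \<open>The \<open>- 2 / n\<close> from the logarithm cancels the
      \<open>- 2 / n\<close> in \<open>fps_nth_zagier_poly\<close>, which enters with a minus
      sign.\<close>
    thus ?thesis using that
      unfolding G_def fps_sub_nth by (subst fps_nth_zagier_poly) auto
  qed
  ultimately have g: "(\<lambda>z. g z - (\<Sum>n=0..N. ?v n * z ^ n)) \<in> O[at_right 0](\<lambda>z. z ^ (N + 1))"
    by (rule has_fps_expansion_imp_bigo)

  \<comment> \<open>For \<open>x = -1\<close> the digamma argument \<open>?w z + 1 - x\<close> is
    \<open>z + 1 / z\<close>, and the shift by 2 makes \<open>?w z\<close> equal to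
    \<open>(1 - z) ^ 2 / z\<close>, whose logarithm splits.\<close>
  let ?w = "\<lambda>z::real. z + 1 / z - 2"
  have "filterlim (\<lambda>z::real. inverse z) at_top (at_right 0)"
    by (rule filterlim_inverse_at_top_right)
  hence "filterlim (\<lambda>z::real. (z - 2) + inverse z) at_top (at_right 0)"
    by (intro filterlim_tendsto_add_at_top[of _ "0 - 2"] tendsto_intros)
  hence "filterlim ?w at_top (at_right 0)"
    by (simp add: inverse_eq_divide algebra_simps)
  from landau_o.big.compose[OF Digamma_bernoulli_asymptotics[of "- 1" N] this]
  have "(\<lambda>z. Digamma (z + 1 / z) - (ln (?w z) - (\<Sum>r=1..N + 1. ?B r * (1 / ?w z) ^ r)))
          \<in> O[at_right 0](\<lambda>z. (1 / ?w z) ^ (N + 1))"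
    by simp
  also have "?this \<longleftrightarrow> (\<lambda>z. V z - g z) \<in> O[at_right 0](\<lambda>z. (1 / ?w z) ^ (N + 1))"
  proof (rule landau_o.big.in_cong)
    have "eventually (\<lambda>z::real. z \<in> {0<..<1}) (at_right 0)"
      by (rule eventually_at_right_real) simp
    thus "eventually (\<lambda>z. Digamma (z + 1 / z) -
              (ln (?w z) - (\<Sum>r=1..N + 1. ?B r * (1 / ?w z) ^ r)) = V z - g z) (at_right 0)"
    proof eventually_elim
      case (elim z)
      hence w: "?w z = (1 - z) ^ 2 / z"
        by (simp add: field_simps power2_eq_square)
      have 1: "ln (?w z) = 2 * ln (1 - z) - ln z"
        unfolding w using elim by (simp add: ln_div ln_realpow)
      have 2: "(1 / ?w z) ^ r = z ^ r / (1 - z) ^ (2 * r)" for r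
        unfolding w by (simp add: power_divide power_mult)
      show ?case
        unfolding 1 2 by (simp add: V_def g_def)
    qed
  qed
  finally have "(\<lambda>z. V z - g z) \<in> O[at_right 0](\<lambda>z. (1 / ?w z) ^ (N + 1))" .
  \<comment> \<open>Since \<open>1 / ?w z = z / (1 - z) ^ 2\<close>, the constant 4 works for
    \<open>0 < z < 1/2\<close>.\<close>
  also have "(\<lambda>z. (1 / ?w z) ^ (N + 1)) \<in> O[at_right 0](\<lambda>z. z ^ (N + 1))"
  proof (rule landau_o.big_power, rule bigoI)
    have "eventually (\<lambda>z::real. z \<in> {0<..<1/2}) (at_right 0)"
      by (rule eventually_at_right_real) simp
    thus "eventually (\<lambda>z. norm (1 / ?w z) \<le> 4 * norm z) (at_right 0)"
    proof eventually_elim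
      case (elim z)
      hence w: "?w z = (1 - z) ^ 2 / z"
        by (simp add: field_simps power2_eq_square)
      have "(1 / 2) ^ 2 \<le> (1 - z) ^ 2"
        using elim by (intro power_mono) auto
      hence "z * 1 \<le> z * (4 * (1 - z) ^ 2)"
        using elim by (intro mult_left_mono) (auto simp: power_divide)
      thus ?case
        unfolding w using elim by (simp add: field_simps)
    qed
  qed
  finally have "(\<lambda>z. (V z - g z) + (g z - (\<Sum>n=0..N. ?v n * z ^ n)))
                  \<in> O[at_right 0](\<lambda>z. z ^ (N + 1))"
    using g by (rule sum_in_bigo)
  thus "(\<lambda>z. V z - (\<Sum>n=0..N. ?v n * z ^ n)) \<in> O[at_right 0](\<lambda>z. z ^ (N + 1))"
    by simp
qed

text \<open>The first conjunct makes the numbers \<open>v n\<close> well defined, so the second is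
  not vacuous.\<close>

theorem theorem1p4:
  "(\<exists>!v. has_asymp_expansion_at_0 V v) \<and>
   (\<forall>v. has_asymp_expansion_at_0 V v \<longrightarrow> (\<forall>n\<ge>1. v n = - 2 * zagier_poly n (- 1)))"
proof (intro conjI allI impI)
  show "\<exists>!v. has_asymp_expansion_at_0 V v"
    using has_asymp_expansion_at_0_V has_asymp_expansion_at_0_unique by blast
next
  fix v and n :: nat
  assume "has_asymp_expansion_at_0 V v" "n \<ge> 1"
  hence "v n = (if n = 0 then 0 else - 2 * zagier_poly n (- 1))"
    using has_asymp_expansion_at_0_unique[OF _ has_asymp_expansion_at_0_V] by metis
  thus "v n = - 2 * zagier_poly n (- 1)"
    using \<open>n \<ge> 1\<close> by simp
qed

end
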